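(* Let $P$ be a set of basic facts, let $P_1, P_2 \subseteq P$ be the sets of basic facts of Side A and Side B, and let $L_1, L_2$ be the languages of Side A and Side B generated in the communication model from $P_1$ and $P_2$. If $P_1 \supseteq P$ and $P_2 \supseteq P$, then $L_1 = L_2$.
   Context: Let $P$ be a set of symbols ("basic facts", the elements of the final requirement specification), disjoint from the set of three symbols $\{1, 2, .\}$. The terminal alphabet is $T = P \cup \{1,2\} \cup \{.\}$, and languages are sets of words over $T$. Side A (agent 1) has a set $P_1 \subseteq P$ of basic facts and Side B (agent 2) has a set $P_2 \subseteq P$. The word $w.1$ (concatenation of $w$, the separator "." and the symbol 1) encodes "Side A knows $w$", and $w.2$ encodes "Side B knows $w$". Communication model. The languages $L_1$ (start symbol $S_1$) and $L_2$ (start symbol $S_2$) are generated simultaneously, i.e. they are the smallest pair of languages closed under the following productions: - $S_1 \rightarrow xV$ for each $x \in P_1$; $S_2 \rightarrow xU$ for each $x \in P_2$; - $V \rightarrow V.1$, $V \rightarrow \varepsilon$; $U \rightarrow U.2$, $U \rightarrow \varepsilon$; - $S_1 \rightarrow M.2V$ for each word $M \in L_2$ (Side B tells $M$ to Side A); - $S_2 \rightarrow N.1U$ for each word $N \in L_1$ (Side A tells $N$ to Side B). Equivalently, $(L_1, L_2)$ is the smallest pair of sets of words such that, for all $k \ge 0$: $x(.1)^k \in L_1$ for $x \in P_1$; $M.2(.1)^k \in L_1$ for $M \in L_2$; $x(.2)^k \in L_2$ for $x \in P_2$; $N.1(.2)^k \in L_2$ for $N \in L_1$. Here $(.i)^k$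 denotes the word $.i$ repeated $k$ times. *)

theory Defs
  imports Main
begin

text \<open>
  The terminal alphabet is the disjoint union of the basic facts and the three symbols
  \<open>1\<close>, \<open>2\<close> and the separator; disjointness is built in through the constructors.
  Words are lists, so \<open>w.1\<close> is \<open>w @ [Dot, One]\<close>.
\<close>

datatype 'p symbol = Fact 'p | One | Two | Dot

text \<open>Words derivable from the nonterminals \<open>V\<close> and \<open>U\<close>.\<close>

inductive_set V_lang :: "'p symbol list set" where
  V_eps: "[] \<in> V_lang"
| V_step: "v \<in> V_lang \<Longrightarrow> v @ [Dot, One] \<in> V_lang"

inductive_set U_lang :: "'p symbol list set" where
  U_eps: "[] \<in> U_lang"
| U_step: "u \<in> U_lang \<Longrightarrow> u @ [Dot, Two] \<in> U_lang"

text \<open>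
  The languages of the start symbols \<open>S\<^sub>1\<close> and \<open>S\<^sub>2\<close>, with one rule for each kind of production.
  The simultaneous inductive definition is the smallest pair closed under the productions.
\<close>

inductive_set L1 :: "'p set \<Rightarrow> 'p set \<Rightarrow> 'p symbol list set"
  and L2 :: "'p set \<Rightarrow> 'p set \<Rightarrow> 'p symbol list set"
  for P1 P2 :: "'p set"
where
  L1_fact: "x \<in> P1 \<Longrightarrow> v \<in> V_lang \<Longrightarrow> [Fact x] @ v \<in> L1 P1 P2"
| L1_told: "M \<in> L2 P1 P2 \<Longrightarrow> v \<in> V_lang \<Longrightarrow> M @ [Dot, Two] @ v \<in> L1 P1 P2"
| L2_fact: "x \<in> P2 \<Longrightarrow> u \<in> U_lang \<Longrightarrow> [Fact x] @ u \<in> L2 P1 P2"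
| L2_told: "N \<in> L1 P1 P2 \<Longrightarrow> u \<in> U_lang \<Longrightarrow> N @ [Dot, One] @ u \<in> L2 P1 P2"

end

theory Submission
  imports Defs
begin

text \<open>
  \<open>L\<^sub>1\<close> is closed under appending \<open>.1\<close> because \<open>V\<close> is, and \<open>L\<^sub>2\<close> under \<open>.2\<close> because \<open>U\<close> is.
  A word known to both sides thus stays known to both when \<open>.1\<close> or \<open>.2\<close> is appended: one
  side has it by its own closure, the other by being told. If both sides have the same basic facts,
  every derivation of a word starts from a word known to both, so it never leaves \<open>L\<^sub>1 \<inter> L\<^sub>2\<close>.
\<close>

lemma L1_append_One:
  assumes "w \<in> L1 P1 P2"
  shows "w @ [Dot, One] \<in> L1 P1 P2"
  using assms
proof cases
  case (L1_fact x v)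
  \<comment> \<open>The same production is used again, with \<open>v @ [Dot, One]\<close> in place
    of \<open>v\<close>.\<close>
  then show ?thesis
    using L1_L2.L1_fact[OF _ V_step] by force
next
  case (L1_told M v)
  then show ?thesis
    using L1_L2.L1_told[OF _ V_step] by force
qed

lemma L2_append_Two:
  assumes "w \<in> L2 P1 P2"
  shows "w @ [Dot, Two] \<in> L2 P1 P2"
  using assms
proof cases
  case (L2_fact x u)
  then show ?thesis
    using L1_L2.L2_fact[OF _ U_step] by force
next
  case (L2_told N u)
  then show ?thesis
    using L1_L2.L2_told[OF _ U_step] by force
qed

text \<open>With the empty \<open>U_lang\<close> word, \<open>L2_told\<close> yields exactly
  \<open>w @ [Dot, One]\<close>.\<close>

lemma L1_inter_L2_append_One:
  assumes "w \<in> L1 P1 P2 \<inter> L2 P1 P2"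
  shows "w @ [Dot, One] \<in> L1 P1 P2 \<inter> L2 P1 P2"
  using assms L1_append_One L2_told[OF _ U_eps] by fastforce

lemma L1_inter_L2_append_Two:
  assumes "w \<in> L1 P1 P2 \<inter> L2 P1 P2"
  shows "w @ [Dot, Two] \<in> L1 P1 P2 \<inter> L2 P1 P2"
  using assms L2_append_Two L1_told[OF _ V_eps] by fastforce

lemma L1_inter_L2_append_V:
  assumes "v \<in> V_lang" and "w \<in> L1 P1 P2 \<inter> L2 P1 P2"
  shows "w @ v \<in> L1 P1 P2 \<inter> L2 P1 P2"
  using assms
proof induction
  case V_eps
  then show ?case by simp
next
  case (V_step v)
  \<comment> \<open>\<open>V_step\<close> extends on the right, so the induction hypothesis covers
    the prefix \<open>w @ v\<close>.\<close>
  then show ?case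
    using L1_inter_L2_append_One[of "w @ v"] by simp
qed

lemma L1_inter_L2_append_U:
  assumes "u \<in> U_lang" and "w \<in> L1 P1 P2 \<inter> L2 P1 P2"
  shows "w @ u \<in> L1 P1 P2 \<inter> L2 P1 P2"
  using assms
proof induction
  case U_eps
  then show ?case by simp
next
  case (U_step u)
  then show ?case
    using L1_inter_L2_append_Two[of "w @ u"] by simp
qed

lemma fact_in_L1_inter_L2:
  assumes "x \<in> P1" and "x \<in> P2"
  shows "[Fact x] \<in> L1 P1 P2 \<inter> L2 P1 P2"
  using assms L1_fact[OF _ V_eps] L2_fact[OF _ U_eps] by fastforce

text \<open>The induction is simultaneous because each telling rule takes its premise from the other
  language.\<close>

lemma L1_L2_same_facts:
  shows "w \<in> L1 P P \<Longrightarrow> w \<in> L1 P P \<inter> L2 P P"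
    and "w' \<in> L2 P P \<Longrightarrow> w' \<in> L1 P P \<inter> L2 P P"
proof (induction rule: L1_L2.inducts)
  case (L1_fact x v)
  then show ?case
    by (intro L1_inter_L2_append_V fact_in_L1_inter_L2)
next
  case (L1_told M v)
  then show ?case
    using L1_inter_L2_append_V[OF _ L1_inter_L2_append_Two] by fastforce
next
  case (L2_fact x u)
  then show ?case
    by (intro L1_inter_L2_append_U fact_in_L1_inter_L2)
next
  case (L2_told N u)
  then show ?case
    using L1_inter_L2_append_U[OF _ L1_inter_L2_append_One] by fastforce
qed

theorem theorem4p5:
  fixes P P1 P2 :: "'p set"
  assumes "P1 \<subseteq> P" and "P2 \<subseteq> P"
    and "P1 \<supseteq> P" and "P2 \<supseteq> P"
  shows "L1 P1 P2 = L2 P1 P2"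
proof -
  have "P1 = P" "P2 = P"
    using assms by auto
  then show ?thesis
    using L1_L2_same_facts by blast
qed

end
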